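(* Let $G_5\subset \mathrm{G}\mathbb{I}(4)$ be the group of simply isotropic limit motions. The 1-parameter subgroups of $G_5$ are given by $$\psi_t=\begin{pmatrix}1&0&0&a\,t\\ 0&1&0&b\,t\\ c_1t&c_2t&1&c\,t+(ac_1+bc_2)\frac{t^2}{2}\\ 0&0&0&1\end{pmatrix},\qquad t\in\mathbb{R},$$ with constants $a,b,c,c_1,c_2\in\mathbb{R}$. That is, every continuous group homomorphism $\psi:(\mathbb{R},+)\to G_5$ is of this form for some $a,b,c,c_1,c_2\in\mathbb{R}$, and every choice of these constants gives such a homomorphism.
   Context: The simply isotropic space $\mathbb{I}^3$ is $\mathbb{R}^3$ with the degenerate inner product $\langle u,v\rangle_z=u^1v^1+u^2v^2$ and, on isotropic vectors (those with $u^1=u^2=0$), the codistance $\mathrm{cd}_z(u,v)=|u^3-v^3|$. $\mathrm{O}\mathbb{I}(3)$ is the set of real $3\times 3$ matrices preserving $\langle\cdot,\cdot\rangle_z$, and preserving $\mathrm{cd}_z$ on isotropic vectors; its elements are $$\begin{pmatrix}\cos\phi&-\sigma\sin\phi&0\\ \sin\phi&\sigma\cos\phi&0\\ p&q&\tau\end{pmatrix},\qquad \phi,p,q\in\mathbb{R},\ \sigma,\tau\in\{-1,1\}.$$ $\mathrm{G}\mathbb{I}(4)$ is the group of matrices $\begin{pmatrix}A&\mathbf{a}\\0&1\end{pmatrix}\in GL(4,\mathbb{R})$ with $A\in\mathrm{O}\mathbb{I}(3)$, $\mathbf{a}\in\mathbb{R}^3$; such a matrix represents the isometry $x\mapsto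 Ax+\mathbf{a}$. The top view plane is the $xy$-plane. The group $G_5$ of limit motions consists of the motions which act in the top view plane as a pure translation or as the identity, i.e. of the matrices $$\begin{pmatrix}1&0&0&a\\0&1&0&b\\c_1&c_2&1&c\\0&0&0&1\end{pmatrix},\qquad a,b,c,c_1,c_2\in\mathbb{R}.$$ A 1-parameter subgroup $H$ of a group $G$ is a subgroup for which there is a surjective continuous group homomorphism $\psi:(\mathbb{R},+)\to H$; one identifies $H$ with $\psi$ and writes $\psi_t=\psi(t)$. *)

theory Defs
  imports "HOL-Analysis.Analysis" "HOL-Algebra.Group"
begin

definition inner_z :: "real^3 \<Rightarrow> real^3 \<Rightarrow> real"
  where "inner_z u v = u$1 * v$1 + u$2 * v$2"

definition isotropic :: "real^3 \<Rightarrow> bool"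
  where "isotropic u \<longleftrightarrow> u$1 = 0 \<and> u$2 = 0"

definition codist_z :: "real^3 \<Rightarrow> real^3 \<Rightarrow> real"
  where "codist_z u v = \<bar>u$3 - v$3\<bar>"

text \<open>Preservation of the degenerate inner product already forces isotropic vectors to be
  mapped to isotropic vectors, so the codistance of the images is meaningful.\<close>

definition OI3 :: "(real^3^3) set"
  where "OI3 = {A. (\<forall>u v. inner_z (A *v u) (A *v v) = inner_z u v) \<and>
    (\<forall>u v. isotropic u \<longrightarrow> isotropic v \<longrightarrow> codist_z (A *v u) (A *v v) = codist_z u v)}"

definition affine_matrix :: "real^3^3 \<Rightarrow> real^3 \<Rightarrow> real^4^4"
  where "affine_matrix A a = vector
    [vector [A$1$1, A$1$2, A$1$3, a$1],
     vector [A$2$1, A$2$2, A$2$3, a$2],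
     vector [A$3$1, A$3$2, A$3$3, a$3],
     vector [0,     0,     0,     1]]"

definition GI4 :: "(real^4^4) monoid"
  where "GI4 = \<lparr>carrier = {M. invertible M \<and> (\<exists>A\<in>OI3. \<exists>a. M = affine_matrix A a)},
    monoid.mult = (\<lambda>M N. M ** N), one = mat 1\<rparr>"

text \<open>Motions acting in the top view plane as a translation or as the identity. They have
  lower right entry \<open>1\<close> in the linear part, i.e. reflections in z-direction are not motions.\<close>

definition limit_motion :: "real \<Rightarrow> real \<Rightarrow> real \<Rightarrow> real \<Rightarrow> real \<Rightarrow> real^4^4"
  where "limit_motion a b c c1 c2 = vector
    [vector [1,  0,  0, a],
     vector [0,  1,  0, b],
     vector [c1, c2, 1, c],
     vector [0,  0,  0, 1]]"

definition limit_motions :: "(real^4^4) set"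
  where "limit_motions = {limit_motion a b c c1 c2 | a b c c1 c2. True}"

definition G5 :: "(real^4^4) monoid"
  where "G5 = GI4\<lparr>carrier := limit_motions\<rparr>"

definition real_add_group :: "real monoid"
  where "real_add_group = \<lparr>carrier = UNIV, monoid.mult = (+), one = 0\<rparr>"

text \<open>Matrix groups carry the subspace topology of the space of all matrices, so continuity of a
  map into such a group is continuity as a matrix-valued map.\<close>

definition continuous_hom :: "(real^4^4) monoid \<Rightarrow> (real \<Rightarrow> real^4^4) \<Rightarrow> bool"
  where "continuous_hom G \<psi> \<longleftrightarrow> \<psi> \<in> hom real_add_group G \<and> continuous_on UNIV \<psi>"

definition one_parameter_subgroup :: "(real^4^4) set \<Rightarrow> (real^4^4) monoid \<Rightarrow> bool"
  where "one_parameter_subgroup H G \<longleftrightarrow>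
    subgroup H G \<and> (\<exists>\<psi>. continuous_hom (G\<lparr>carrier := H\<rparr>) \<psi> \<and> range \<psi> = H)"

definition limit_psi :: "real \<Rightarrow> real \<Rightarrow> real \<Rightarrow> real \<Rightarrow> real \<Rightarrow> real \<Rightarrow> real^4^4"
  where "limit_psi a b c c1 c2 t = vector
    [vector [1,      0,      0, a * t],
     vector [0,      1,      0, b * t],
     vector [c1 * t, c2 * t, 1, c * t + (a * c1 + b * c2) * (t\<^sup>2 / 2)],
     vector [0,      0,      0, 1]]"

lemma vector_4_nth:
  "(vector [w, x, y, z] :: 'a::zero^4) $ 1 = w"
  "(vector [w, x, y, z] :: 'a^4) $ 2 = x"
  "(vector [w, x, y, z] :: 'a^4) $ 3 = y"
  "(vector [w, x, y, z] :: 'a^4) $ 4 = z"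
  unfolding vector_def by simp_all

lemma limit_motion_mult:
  "limit_motion a b c c1 c2 ** limit_motion a' b' c' c1' c2' =
   limit_motion (a + a') (b + b') (c + c' + c1 * a' + c2 * b') (c1 + c1') (c2 + c2')"
  by (simp add: limit_motion_def vec_eq_iff forall_4 matrix_matrix_mult_def sum_4 vector_4_nth)

lemma limit_motion_0: "limit_motion 0 0 0 0 0 = mat 1"
  by (simp add: limit_motion_def vec_eq_iff forall_4 mat_def vector_4_nth)

lemma limit_motion_inverse:
  "limit_motion a b c c1 c2 ** limit_motion (-a) (-b) (c1 * a + c2 * b - c) (-c1) (-c2) = mat 1"
  "limit_motion (-a) (-b) (c1 * a + c2 * b - c) (-c1) (-c2) ** limit_motion a b c c1 c2 = mat 1"
  by (simp_all add: limit_motion_mult flip: limit_motion_0)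

lemma limit_motions_subset_GI4: "limit_motions \<subseteq> carrier GI4"
proof
  fix M assume "M \<in> limit_motions"
  then obtain a b c c1 c2 where M: "M = limit_motion a b c c1 c2"
    by (auto simp: limit_motions_def)
  define A :: "real^3^3" where "A = vector [vector [1, 0, 0], vector [0, 1, 0], vector [c1, c2, 1]]"
  have "A \<in> OI3"
    by (simp add: OI3_def A_def inner_z_def isotropic_def codist_z_def
        matrix_vector_mult_def sum_3)
  moreover have "M = affine_matrix A (vector [a, b, c])"
    by (simp add: M A_def affine_matrix_def limit_motion_def)
  moreover have "invertible M"
    using limit_motion_inverse unfolding M invertible_def by blast
  ultimately show "M \<in> carrier GI4"
    by (auto simp: GI4_def)
qed

lemma group_G5: "group G5"
proof (rule groupI)
  fix x y z assume "x \<in> carrier G5"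
  show "x \<otimes>\<^bsub>G5\<^esub> y \<otimes>\<^bsub>G5\<^esub> z = x \<otimes>\<^bsub>G5\<^esub> (y \<otimes>\<^bsub>G5\<^esub> z)"
    by (simp add: G5_def GI4_def matrix_mul_assoc)
  show "\<exists>y\<in>carrier G5. y \<otimes>\<^bsub>G5\<^esub> x = \<one>\<^bsub>G5\<^esub>"
    using \<open>x \<in> carrier G5\<close> limit_motion_inverse(2)
    by (fastforce simp: G5_def GI4_def limit_motions_def)
next
  show "\<one>\<^bsub>G5\<^esub> \<in> carrier G5"
    by (simp add: G5_def GI4_def limit_motions_def) (metis limit_motion_0)
qed (auto simp: G5_def GI4_def limit_motions_def limit_motion_mult, blast)

end

theory Submission
  imports Defs
begin

text \<open>
  In the coordinates \<open>(a, b, c, c1, c2)\<close> of \<^const>\<open>limit_motion\<close>, multiplication of motions adds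
  \<open>a\<close>, \<open>b\<close>, \<open>c1\<close> and \<open>c2\<close>, and adds \<open>c\<close> up to the bilinear correction \<open>c1 * a' + c2 * b'\<close>.  So
  along a continuous homomorphism the four coordinates \<open>a\<close>, \<open>b\<close>, \<open>c1\<close>, \<open>c2\<close> solve Cauchy's
  functional equation and are linear in the parameter
  (\<open>continuous_additive_real_imp_linear\<close>).  The correction then becomes \<open>k * s * t\<close> for the
  constant \<open>k = a * c1 + b * c2\<close>.  It is the defect from additivity of the quadratic function
  \<open>k * (t\<^sup>2 / 2)\<close>, and removing this function from \<open>c\<close> leaves one more continuous additive
  function (\<open>continuous_additive_defect\<close>), which is what the asserted form expresses.

  The converse is a direct multiplication.  The description of the subgroups follows because a
  continuous homomorphism onto a subgroup is a continuous homomorphism into the ambient group, and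
  because the image of a homomorphism is a subgroup.
\<close>

section \<open>Cauchy's functional equation\<close>

text \<open>Additivity fixes \<open>f\<close> on the rationals, which are dense, and the set where two continuous
  functions agree is closed.\<close>

lemma continuous_additive_real_imp_linear:
  fixes f :: "real \<Rightarrow> real"
  assumes cont: "continuous_on UNIV f" and add: "\<And>s t. f (s + t) = f s + f t"
  shows "f t = f 1 * t"
proof -
  interpret additive f
    by standard (rule add)
  have nat_mult: "f (real n * x) = real n * f x" for n x
    by (induction n) (auto simp: zero add algebra_simps)
  have int_mult: "f (of_int i * x) = of_int i * f x" for i x
    by (cases i rule: int_cases2) (simp_all add: nat_mult minus)
  have "f q = f 1 * q" if "q \<in> \<rat>" for q
  proof -
    obtain i n where q: "q = of_int i / of_int n" and n: "n > 0"
      using \<open>q \<in> \<rat>\<close> by (rule Rats_cases')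
    have i: "of_int i = of_int n * q"
      using n q by simp
    have "of_int n * f q = f (of_int i * 1)"
      by (simp add: i int_mult)
    also have "\<dots> = of_int n * (f 1 * q)"
      unfolding int_mult by (simp add: i)
    finally show ?thesis
      using n by simp
  qed
  then have "\<rat> \<subseteq> {x. f x = f 1 * x}"
    by blast
  moreover have "closed {x. f x = f 1 * x}"
    by (intro closed_Collect_eq continuous_intros cont)
  ultimately have "closure \<rat> \<subseteq> {x. f x = f 1 * x}"
    by (rule closure_minimal)
  then show ?thesis
    by (auto simp: Rats_closure_real)
qed

text \<open>The quadratic term has the prescribed defect because
  \<open>(s + t)\<^sup>2 / 2 = s\<^sup>2 / 2 + t\<^sup>2 / 2 + s * t\<close>, so subtracting it reduces the equation to Cauchy's.\<close>

lemma continuous_additive_defect: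
  fixes f :: "real \<Rightarrow> real"
  assumes cont: "continuous_on UNIV f" and eq: "\<And>s t. f (s + t) = f s + f t + k * s * t"
  obtains c where "\<And>t. f t = c * t + k * (t\<^sup>2 / 2)"
proof -
  define g where "g t = f t - k * (t\<^sup>2 / 2)" for t
  have "continuous_on UNIV g"
    unfolding g_def by (intro continuous_intros cont) auto
  moreover have "g (s + t) = g s + g t" for s t
    by (simp add: g_def eq power2_eq_square field_simps)
  ultimately have "g t = g 1 * t" for t
    by (rule continuous_additive_real_imp_linear)
  then have "f t = g 1 * t + k * (t\<^sup>2 / 2)" for t
    using g_def[of t] by (metis diff_add_cancel)
  then show ?thesis
    by (rule that)
qed

section \<open>Homomorphisms into the group of limit motions\<close>

lemma limit_psi_eq_limit_motion:
  "limit_psi a b c c1 c2 t =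
    limit_motion (a * t) (b * t) (c * t + (a * c1 + b * c2) * (t\<^sup>2 / 2)) (c1 * t) (c2 * t)"
  by (simp add: limit_psi_def limit_motion_def)

lemma continuous_hom_G5_iff:
  "continuous_hom G5 \<psi> \<longleftrightarrow>
    range \<psi> \<subseteq> limit_motions \<and> (\<forall>s t. \<psi> (s + t) = \<psi> s ** \<psi> t) \<and> continuous_on UNIV \<psi>"
  by (auto simp: continuous_hom_def hom_def real_add_group_def G5_def GI4_def)

lemma limit_motion_nth:
  "limit_motion a b c c1 c2 $ 1 $ 4 = a"
  "limit_motion a b c c1 c2 $ 2 $ 4 = b"
  "limit_motion a b c c1 c2 $ 3 $ 4 = c"
  "limit_motion a b c c1 c2 $ 3 $ 1 = c1"
  "limit_motion a b c c1 c2 $ 3 $ 2 = c2"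
  by (simp_all add: limit_motion_def vector_4_nth)

lemma limit_motion_eq_iff:
  "limit_motion a b c c1 c2 = limit_motion a' b' c' c1' c2' \<longleftrightarrow>
    a = a' \<and> b = b' \<and> c = c' \<and> c1 = c1' \<and> c2 = c2'"
  by (metis limit_motion_nth)

lemma continuous_hom_limit_psi: "continuous_hom G5 (limit_psi a b c c1 c2)"
proof -
  have "range (limit_psi a b c c1 c2) \<subseteq> limit_motions"
    unfolding limit_psi_eq_limit_motion limit_motions_def by blast
  moreover have "limit_psi a b c c1 c2 (s + t) = limit_psi a b c c1 c2 s ** limit_psi a b c c1 c2 t"
    for s t
    by (simp add: limit_psi_eq_limit_motion limit_motion_mult limit_motion_eq_iff
        power2_eq_square field_simps)
  moreover have "continuous_on UNIV (limit_psi a b c c1 c2)"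
  proof -
    have "continuous_on UNIV (\<lambda>t. limit_psi a b c c1 c2 t $ i $ j)" for i j
      using exhaust_4[of i] exhaust_4[of j]
      by (elim disjE; simp add: limit_psi_def vector_4_nth; (intro continuous_intros; simp)?)
    then have "continuous_on UNIV (\<lambda>t. \<chi> i j. limit_psi a b c c1 c2 t $ i $ j)"
      by (intro continuous_on_vec_lambda)
    then show ?thesis
      by simp
  qed
  ultimately show ?thesis
    by (simp add: continuous_hom_G5_iff)
qed

lemma continuous_hom_G5_imp_limit_psi:
  assumes "continuous_hom G5 \<psi>"
  shows "\<exists>a b c c1 c2. \<forall>t. \<psi> t = limit_psi a b c c1 c2 t"
proof -
  define a b c c1 c2 where
    coords: "a = (\<lambda>t. \<psi> t $ 1 $ 4)" "b = (\<lambda>t. \<psi> t $ 2 $ 4)" "c = (\<lambda>t. \<psi> t $ 3 $ 4)"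
      "c1 = (\<lambda>t. \<psi> t $ 3 $ 1)" "c2 = (\<lambda>t. \<psi> t $ 3 $ 2)"
  have \<psi>: "\<psi> t = limit_motion (a t) (b t) (c t) (c1 t) (c2 t)" for t
  proof -
    have "\<psi> t \<in> limit_motions"
      using assms by (auto simp: continuous_hom_G5_iff)
    then show ?thesis
      by (auto simp: limit_motions_def coords limit_motion_nth)
  qed
  have "\<psi> (s + t) = \<psi> s ** \<psi> t" for s t
    using assms by (simp add: continuous_hom_G5_iff)
  then have add: "a (s + t) = a s + a t" "b (s + t) = b s + b t"
      "c1 (s + t) = c1 s + c1 t" "c2 (s + t) = c2 s + c2 t"
    and c_add: "c (s + t) = c s + c t + c1 s * a t + c2 s * b t" for s t
    unfolding \<psi> limit_motion_mult limit_motion_eq_iff by blast+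
  have "continuous_on UNIV \<psi>"
    using assms by (simp add: continuous_hom_G5_iff)
  then have cont: "continuous_on UNIV a" "continuous_on UNIV b" "continuous_on UNIV c"
      "continuous_on UNIV c1" "continuous_on UNIV c2"
    unfolding coords by (intro continuous_on_component; assumption)+
  have lin: "a t = a 1 * t" "b t = b 1 * t" "c1 t = c1 1 * t" "c2 t = c2 1 * t" for t
    by (rule continuous_additive_real_imp_linear; fact cont add)+
  have "c (s + t) = c s + c t + (a 1 * c1 1 + b 1 * c2 1) * s * t" for s t
    unfolding c_add lin[of s] lin[of t] by (simp add: algebra_simps)
  then obtain d where "c t = d * t + (a 1 * c1 1 + b 1 * c2 1) * (t\<^sup>2 / 2)" for t
    using continuous_additive_defect[OF cont(3)] by blast
  then have "\<psi> t = limit_psi (a 1) (b 1) d (c1 1) (c2 1) t" for t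
    unfolding \<psi> limit_psi_eq_limit_motion limit_motion_eq_iff using lin by blast
  then show ?thesis
    by blast
qed

section \<open>One-parameter subgroups as images of homomorphisms\<close>

lemma group_real_add_group: "group real_add_group"
proof (rule groupI)
  fix x assume "x \<in> carrier real_add_group"
  show "\<exists>y\<in>carrier real_add_group. y \<otimes>\<^bsub>real_add_group\<^esub> x = \<one>\<^bsub>real_add_group\<^esub>"
    by (rule bexI[of _ "- x"]) (simp_all add: real_add_group_def)
qed (simp_all add: real_add_group_def)

lemma continuous_hom_restrict_iff:
  assumes "H \<subseteq> carrier G"
  shows "continuous_hom (G\<lparr>carrier := H\<rparr>) \<psi> \<longleftrightarrow> continuous_hom G \<psi> \<and> range \<psi> \<subseteq> H"
  using assms by (auto simp: continuous_hom_def hom_def real_add_group_def)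

lemma subgroup_range_continuous_hom:
  assumes "group G" and "continuous_hom G \<psi>"
  shows "subgroup (range \<psi>) G"
proof -
  interpret group_hom real_add_group G \<psi>
    using assms group_real_add_group
    by (simp add: group_hom_def group_hom_axioms_def continuous_hom_def)
  show ?thesis
    using img_is_subgroup by (simp add: real_add_group_def)
qed

lemma one_parameter_subgroup_iff:
  assumes "group G"
  shows "one_parameter_subgroup H G \<longleftrightarrow> (\<exists>\<psi>. continuous_hom G \<psi> \<and> H = range \<psi>)"
proof
  assume "one_parameter_subgroup H G"
  then obtain \<psi> where "subgroup H G" "continuous_hom (G\<lparr>carrier := H\<rparr>) \<psi>" "range \<psi> = H"
    by (auto simp: one_parameter_subgroup_def)
  then show "\<exists>\<psi>. continuous_hom G \<psi> \<and> H = range \<psi>"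
    using continuous_hom_restrict_iff[OF subgroup.subset] by blast
next
  assume "\<exists>\<psi>. continuous_hom G \<psi> \<and> H = range \<psi>"
  then obtain \<psi> where \<psi>: "continuous_hom G \<psi>" and H: "H = range \<psi>"
    by blast
  have sub: "subgroup H G"
    unfolding H using assms \<psi> by (rule subgroup_range_continuous_hom)
  then have "continuous_hom (G\<lparr>carrier := H\<rparr>) \<psi>"
    using continuous_hom_restrict_iff[OF subgroup.subset] \<psi> H by blast
  with sub H show "one_parameter_subgroup H G"
    unfolding one_parameter_subgroup_def by blast
qed

theorem theorem3p1:
  shows "(\<forall>\<psi>. continuous_hom G5 \<psi> \<longrightarrow> (\<exists>a b c c1 c2. \<forall>t. \<psi> t = limit_psi a b c c1 c2 t)) \<and>
    (\<forall>a b c c1 c2. continuous_hom G5 (limit_psi a b c c1 c2)) \<and>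
    (\<forall>H. one_parameter_subgroup H G5 \<longleftrightarrow>
      (\<exists>a b c c1 c2. H = range (limit_psi a b c c1 c2)))"
proof (intro conjI allI impI)
  fix H
  show "one_parameter_subgroup H G5 \<longleftrightarrow> (\<exists>a b c c1 c2. H = range (limit_psi a b c c1 c2))"
  proof
    assume "one_parameter_subgroup H G5"
    then obtain \<psi> where "continuous_hom G5 \<psi>" and H: "H = range \<psi>"
      by (auto simp: one_parameter_subgroup_iff group_G5)
    then obtain a b c c1 c2 where "\<forall>t. \<psi> t = limit_psi a b c c1 c2 t"
      using continuous_hom_G5_imp_limit_psi by blast
    then have "\<psi> = limit_psi a b c c1 c2"
      by blast
    then show "\<exists>a b c c1 c2. H = range (limit_psi a b c c1 c2)"
      using H by blast
  next
    assume "\<exists>a b c c1 c2. H = range (limit_psi a b c c1 c2)"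
    then show "one_parameter_subgroup H G5"
      unfolding one_parameter_subgroup_iff[OF group_G5] using continuous_hom_limit_psi by blast
  qed
qed (fact continuous_hom_G5_imp_limit_psi continuous_hom_limit_psi)+

end
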